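(* Let $M$ be a compact Riemannian manifold without boundary with a system of self-adjoint, commuting, jointly elliptic differential operators $L_1,\dots,L_m$, with joint eigenbasis $e_j$, $j\in\mathbb N$, and joint spectrum $\Lambda\subset\mathbb R^m$; let $\lambda_j=(\lambda_{1,j},\dots,\lambda_{m,j})$ be the vector of eigenvalues of $L_1,\dots,L_m$ associated with the eigenfunction $e_j$. Let $E\subset M$ be measurable, let $S$ be a finite subset of $\Lambda$, and let $X_S=\{j:\lambda_j\in S\}$. Suppose there is a nontrivial $f\in L^2(M)$ that is $L^2$-concentrated in $E$ at level $L$ and whose Fourier coefficients $\widehat f$ are $L^2$-concentrated in $X_S$ at level $L'$. Assume further that for each $\lambda\in\Lambda$ the sum $\sum_{j:\lambda_j=\lambda}|e_j(x)|^2$ is constant in $x$. Then $$\#X_S\,\frac{|E|}{|M|}\ge(1-\epsilon-\epsilon')^2,$$ where $L=(1-\epsilon^2)^{-1/2}$ and $L'=(1-\epsilon'^2)^{-1/2}$ with $\epsilon,\epsilon'\in[0,1)$.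
   Context: $dx$ denotes the volume density on $M$, and $|E|$, $|M|$ are the corresponding volumes. The hypotheses on the operators mean: (i) each $L_i$ is self-adjoint in $L^2(dx)$; (ii) $L_i$ and $L_j$ commute for all $i,j$; (iii) $L_1,\dots,L_m$ are jointly elliptic, i.e. $T:=I+\sum_{i=1}^mL_i^2$ is an elliptic differential operator on $M$. Such a system admits a discrete orthonormal basis $\{e_j:j\in\mathbb N\}$ of $L^2(M)$ consisting of joint eigenfunctions, $L_ie_j=\lambda_{i,j}e_j$ for all $i,j$; the joint spectrum is $\Lambda=\{(\lambda_{1,j},\dots,\lambda_{m,j}):j\in\mathbb N\}\subset\mathbb R^m$. The Fourier coefficients of $f$ are $\widehat f(j)=\int_M f\,\overline{e_j}\,dx$, viewed as a function on $\mathbb N$ with counting measure. Concentration: if $X$ is a measure space with measure $\mu$ and $E\subset X$, a function $f\in L^p(X,\mu)$ is $L^p$-concentrated on (in) $E$ at level $L\ge1$ if $\left(\int_X|f|^p\,d\mu\right)^{1/p}\le L\left(\int_E|f|^p\,d\mu\right)^{1/p}$.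
   Formalization: The condition ε+ε' ≤ 1 is added; without it the inequality is false (circle, L_1 = −i d/dx, f = 1, S = {0}, E a half circle, ε = ε' = 0.99 gives 1/2 < 0.9604). *)

theory Defs
  imports "HOL-Analysis.Analysis"
begin

section \<open>Smooth maps between open sets of normed spaces\<close>

primrec Ck_on :: "nat \<Rightarrow> ('a::real_normed_vector \<Rightarrow> 'b::real_normed_vector) \<Rightarrow> 'a set \<Rightarrow> bool" where
  "Ck_on 0 f S \<longleftrightarrow> continuous_on S f"
| "Ck_on (Suc k) f S \<longleftrightarrow>
     (\<forall>x\<in>S. f differentiable (at x)) \<and>
     (\<forall>v. Ck_on k (\<lambda>x. frechet_derivative f (at x) v) S)"

text \<open>Only used for open \<open>S\<close>.\<close>

definition smooth_on :: "('a::real_normed_vector \<Rightarrow> 'b::real_normed_vector) \<Rightarrow> 'a set \<Rightarrow> bool" where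
  "smooth_on f S \<longleftrightarrow> (\<forall>k. Ck_on k f S)"


section \<open>Smooth manifolds and Riemannian metrics\<close>

text \<open>
  The manifold is the whole type \<open>'m\<close> (second countable, Hausdorff). A chart is a pair
  \<open>(U, \<phi>)\<close>; only the restriction of \<open>\<phi>\<close> to \<open>U\<close> matters. The image of a chart is open in
  Euclidean space, so the manifold has no boundary. An atlas need not be maximal: the notions
  below, once imposed on the charts of an atlas, hold in every compatible chart.
\<close>

type_synonym ('m, 'n) chart = "'m set \<times> ('m \<Rightarrow> real ^ 'n)"

definition chart_inv :: "('m, 'n) chart \<Rightarrow> real ^ 'n \<Rightarrow> 'm" where
  "chart_inv c = inv_into (fst c) (snd c)"

definition chart_image :: "('m, 'n) chart \<Rightarrow> (real ^ 'n) set" where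
  "chart_image c = snd c ` fst c"

definition transition :: "('m, 'n) chart \<Rightarrow> ('m, 'n) chart \<Rightarrow> real ^ 'n \<Rightarrow> real ^ 'n" where
  "transition c d = snd d \<circ> chart_inv c"

definition is_chart :: "('m::topological_space, 'n::finite) chart \<Rightarrow> bool" where
  "is_chart c \<longleftrightarrow> open (fst c) \<and> open (chart_image c) \<and>
     homeomorphism (fst c) (chart_image c) (snd c) (chart_inv c)"

definition smooth_atlas ::
  "('m::{second_countable_topology, t2_space}, 'n::finite) chart set \<Rightarrow> bool" where
  "smooth_atlas A \<longleftrightarrow>
     (\<forall>c\<in>A. is_chart c) \<and>
     (\<Union>c\<in>A. fst c) = UNIV \<and>
     (\<forall>c\<in>A. \<forall>d\<in>A. smooth_on (transition c d) (snd c ` (fst c \<inter> fst d)))"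

text \<open>
  A Riemannian metric is given by its Gram matrices in the coordinates of each chart: smooth,
  symmetric, positive definite, and compatible with pullback along the transition maps.
\<close>

definition riemannian_metric ::
  "('m, 'n::finite) chart set \<Rightarrow> (('m, 'n) chart \<Rightarrow> real ^ 'n \<Rightarrow> real ^ 'n ^ 'n) \<Rightarrow> bool" where
  "riemannian_metric A g \<longleftrightarrow>
     (\<forall>c\<in>A. smooth_on (g c) (chart_image c) \<and>
        (\<forall>y\<in>chart_image c. transpose (g c y) = g c y \<and>
           (\<forall>v. v \<noteq> 0 \<longrightarrow> v \<bullet> (g c y *v v) > 0))) \<and>
     (\<forall>c\<in>A. \<forall>d\<in>A. \<forall>y\<in>snd c ` (fst c \<inter> fst d). \<forall>v w.
        v \<bullet> (g c y *v w) =
          frechet_derivative (transition c d) (at y) v \<bullet>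
            (g d (transition c d y) *v frechet_derivative (transition c d) (at y) w))"

definition compact_riemannian_manifold ::
  "('m::{second_countable_topology, t2_space}, 'n::finite) chart set \<Rightarrow>
    (('m, 'n) chart \<Rightarrow> real ^ 'n \<Rightarrow> real ^ 'n ^ 'n) \<Rightarrow> bool" where
  "compact_riemannian_manifold A g \<longleftrightarrow>
     compact (UNIV :: 'm set) \<and> smooth_atlas A \<and> riemannian_metric A g"

text \<open>
  The Riemannian measure is the unique Borel measure that is \<open>sqrt (det g) dy\<close> in every chart.
  It is completed: its measurable sets are the Lebesgue measurable subsets of the manifold.
\<close>

definition riemannian_volume ::
  "('m::{second_countable_topology, t2_space}, 'n::finite) chart set \<Rightarrow>
    (('m, 'n) chart \<Rightarrow> real ^ 'n \<Rightarrow> real ^ 'n ^ 'n) \<Rightarrow> 'm measure \<Rightarrow> bool" where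
  "riemannian_volume A g vol \<longleftrightarrow>
     (\<exists>\<nu>. sets \<nu> = sets borel \<and>
        (\<forall>c\<in>A. \<forall>B\<in>sets borel. B \<subseteq> fst c \<longrightarrow>
           emeasure \<nu> B = (\<integral>\<^sup>+y\<in>snd c ` B. ennreal (sqrt (det (g c y))) \<partial>lborel)) \<and>
        vol = completion \<nu>)"


section \<open>The space of square integrable functions\<close>

definition square_integrable :: "'m measure \<Rightarrow> ('m \<Rightarrow> complex) \<Rightarrow> bool" where
  "square_integrable M f \<longleftrightarrow> f \<in> borel_measurable M \<and> integrable M (\<lambda>x. (cmod (f x))\<^sup>2)"

definition L2_inner :: "'m measure \<Rightarrow> ('m \<Rightarrow> complex) \<Rightarrow> ('m \<Rightarrow> complex) \<Rightarrow> complex" where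
  "L2_inner M f h = (LINT x|M. f x * cnj (h x))"

definition L2_norm :: "'m measure \<Rightarrow> ('m \<Rightarrow> complex) \<Rightarrow> real" where
  "L2_norm M f = sqrt (LINT x|M. (cmod (f x))\<^sup>2)"

definition orthonormal_basis :: "'m measure \<Rightarrow> (nat \<Rightarrow> 'm \<Rightarrow> complex) \<Rightarrow> bool" where
  "orthonormal_basis M e \<longleftrightarrow>
     (\<forall>j. square_integrable M (e j)) \<and>
     (\<forall>j k. L2_inner M (e j) (e k) = (if j = k then 1 else 0)) \<and>
     (\<forall>f. square_integrable M f \<longrightarrow>
        (\<forall>\<delta>>0. \<exists>n a. L2_norm M (\<lambda>x. f x - (\<Sum>j<n. a j * e j x)) < \<delta>))"

definition fourier_coeff ::
  "'m measure \<Rightarrow> (nat \<Rightarrow> 'm \<Rightarrow> complex) \<Rightarrow> ('m \<Rightarrow> complex) \<Rightarrow> nat \<Rightarrow> complex" where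
  "fourier_coeff M e f j = (LINT x|M. f x * cnj (e j x))"

definition Lp_concentrated ::
  "real \<Rightarrow> 'a measure \<Rightarrow> 'a set \<Rightarrow> real \<Rightarrow> ('a \<Rightarrow> complex) \<Rightarrow> bool" where
  "Lp_concentrated p M E L f \<longleftrightarrow>
     E \<in> sets M \<and> L \<ge> 1 \<and>
     f \<in> borel_measurable M \<and> integrable M (\<lambda>x. cmod (f x) powr p) \<and>
     (LINT x|M. cmod (f x) powr p) powr (1 / p)
       \<le> L * (LINT x:E|M. cmod (f x) powr p) powr (1 / p)"


section \<open>Differential operators\<close>

definition smooth_function ::
  "('m, 'n::finite) chart set \<Rightarrow> ('m \<Rightarrow> complex) \<Rightarrow> bool" where
  "smooth_function A f \<longleftrightarrow> (\<forall>c\<in>A. smooth_on (f \<circ> chart_inv c) (chart_image c))"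

primrec partials :: "'n list \<Rightarrow> (real ^ 'n::finite \<Rightarrow> complex) \<Rightarrow> real ^ 'n \<Rightarrow> complex" where
  "partials [] u = u"
| "partials (i # is) u = (\<lambda>y. frechet_derivative (partials is u) (at y) (axis i 1))"

text \<open>
  The operator \<open>D\<close> on smooth functions, read in the chart \<open>c\<close>, has the form
  \<open>\<Sum> a_(i1..ir) \<partial>_i1 .. \<partial>_ir\<close> with smooth coefficients, summed over all \<open>r \<le> k\<close>.
  Sequences of indices replace multi-indices. Since partial derivatives of smooth functions
  commute, only the sums of \<open>a\<close> over the rearrangements of a sequence are determined by \<open>D\<close>;
  these sums are the usual coefficients, and the principal symbol depends only on them.
\<close>

definition local_expression ::
  "('m, 'n::finite) chart set \<Rightarrow> ('m, 'n) chart \<Rightarrow> nat \<Rightarrow>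
    ('n list \<Rightarrow> real ^ 'n \<Rightarrow> complex) \<Rightarrow> (('m \<Rightarrow> complex) \<Rightarrow> 'm \<Rightarrow> complex) \<Rightarrow> bool" where
  "local_expression A c k a D \<longleftrightarrow>
     (\<forall>is. length is \<le> k \<longrightarrow> smooth_on (a is) (chart_image c)) \<and>
     (\<forall>f. smooth_function A f \<longrightarrow>
        (\<forall>x\<in>fst c. D f x =
           (\<Sum>is | length is \<le> k. a is (snd c x) * partials is (f \<circ> chart_inv c) (snd c x))))"

definition symbol ::
  "nat \<Rightarrow> ('n list \<Rightarrow> real ^ 'n::finite \<Rightarrow> complex) \<Rightarrow> real ^ 'n \<Rightarrow> real ^ 'n \<Rightarrow> complex" where
  "symbol k a y \<xi> =
     (\<Sum>is | length is = k. a is y * (\<Prod>i\<leftarrow>is. \<i> * complex_of_real (\<xi> $ i)))"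

definition differential_operator ::
  "('m, 'n::finite) chart set \<Rightarrow> (('m \<Rightarrow> complex) \<Rightarrow> 'm \<Rightarrow> complex) \<Rightarrow> bool" where
  "differential_operator A D \<longleftrightarrow> (\<exists>k. \<forall>c\<in>A. \<exists>a. local_expression A c k a D)"

definition elliptic_operator ::
  "('m, 'n::finite) chart set \<Rightarrow> (('m \<Rightarrow> complex) \<Rightarrow> 'm \<Rightarrow> complex) \<Rightarrow> bool" where
  "elliptic_operator A D \<longleftrightarrow>
     (\<exists>k. \<forall>c\<in>A. \<exists>a. local_expression A c k a D \<and>
        (\<forall>y\<in>chart_image c. \<forall>\<xi>. \<xi> \<noteq> 0 \<longrightarrow> symbol k a y \<xi> \<noteq> 0))"

text \<open>
  The graph of the closure in \<open>L\<^sup>2\<close> of \<open>D\<close> with domain the smooth functions. Self-adjointness says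
  that this graph equals that of its adjoint.
\<close>

definition closure_graph ::
  "('m, 'n::finite) chart set \<Rightarrow> 'm measure \<Rightarrow> (('m \<Rightarrow> complex) \<Rightarrow> 'm \<Rightarrow> complex) \<Rightarrow>
    ('m \<Rightarrow> complex) \<Rightarrow> ('m \<Rightarrow> complex) \<Rightarrow> bool" where
  "closure_graph A M D u w \<longleftrightarrow>
     square_integrable M u \<and> square_integrable M w \<and>
     (\<exists>s. (\<forall>n. smooth_function A (s n)) \<and>
        (\<lambda>n. L2_norm M (\<lambda>x. s n x - u x)) \<longlonglongrightarrow> 0 \<and>
        (\<lambda>n. L2_norm M (\<lambda>x. D (s n) x - w x)) \<longlonglongrightarrow> 0)"

definition self_adjoint ::
  "('m, 'n::finite) chart set \<Rightarrow> 'm measure \<Rightarrow> (('m \<Rightarrow> complex) \<Rightarrow> 'm \<Rightarrow> complex) \<Rightarrow> bool" where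
  "self_adjoint A M D \<longleftrightarrow>
     (\<forall>u w. square_integrable M u \<longrightarrow> square_integrable M w \<longrightarrow>
        (closure_graph A M D u w \<longleftrightarrow>
          (\<forall>v z. closure_graph A M D v z \<longrightarrow> L2_inner M z u = L2_inner M v w)))"

definition elliptic_system ::
  "('m, 'n::finite) chart set \<Rightarrow> 'm measure \<Rightarrow>
    ('k::finite \<Rightarrow> ('m \<Rightarrow> complex) \<Rightarrow> 'm \<Rightarrow> complex) \<Rightarrow> bool" where
  "elliptic_system A M D \<longleftrightarrow>
     (\<forall>i. differential_operator A (D i)) \<and>
     (\<forall>i. self_adjoint A M (D i)) \<and>
     (\<forall>i j f. smooth_function A f \<longrightarrow> D i (D j f) = D j (D i f)) \<and>
     elliptic_operator A (\<lambda>f x. f x + (\<Sum>i\<in>UNIV. D i (D i f) x))"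

text \<open>Joint eigenfunctions are smooth by elliptic regularity.\<close>

definition joint_eigenbasis ::
  "('m, 'n::finite) chart set \<Rightarrow> 'm measure \<Rightarrow>
    ('k::finite \<Rightarrow> ('m \<Rightarrow> complex) \<Rightarrow> 'm \<Rightarrow> complex) \<Rightarrow>
    (nat \<Rightarrow> 'm \<Rightarrow> complex) \<Rightarrow> (nat \<Rightarrow> real ^ 'k) \<Rightarrow> bool" where
  "joint_eigenbasis A M D e lam \<longleftrightarrow>
     orthonormal_basis M e \<and>
     (\<forall>j. smooth_function A (e j)) \<and>
     (\<forall>i j x. D i (e j) x = complex_of_real (lam j $ i) * e j x)"

end

theory Submission
  imports Defs
begin

text \<open>
  Let \<open>P\<close> be the orthogonal projection of \<open>f\<close> to the span of the \<open>e j\<close> with \<open>lam j \<in> S\<close>.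
  Concentration of the Fourier coefficients and Parseval's identity give
  \<open>\<parallel>f - P\<parallel> \<le> \<epsilon>' \<parallel>f\<parallel>\<close>, and concentration of \<open>f\<close> gives that \<open>f\<close> has norm at least
  \<open>sqrt (1 - \<epsilon>\<^sup>2) \<parallel>f\<parallel> \<ge> (1 - \<epsilon>) \<parallel>f\<parallel>\<close> on \<open>E\<close>; so \<open>P\<close> has norm at least
  \<open>(1 - \<epsilon> - \<epsilon>') \<parallel>f\<parallel>\<close> on \<open>E\<close>. The sum of \<open>|e j x|\<^sup>2\<close> over \<open>lam j \<in> S\<close> is a
  constant \<open>C\<close>, and integration over the manifold shows that \<open>C\<close> is the number of these \<open>j\<close>
  divided by the volume. By the Cauchy-Schwarz inequality \<open>|P|\<^sup>2 \<le> C \<parallel>f\<parallel>\<^sup>2\<close> pointwise,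
  and integration over \<open>E\<close> yields the claim. The volume is finite by compactness, and the
  same integration then shows that every joint eigenvalue has finite multiplicity, so that no
  elliptic theory enters.
\<close>

section \<open>Finiteness of the volume\<close>

text \<open>A closed ball around the image of \<open>x\<close> inside the chart image is compact, so
  the continuous density is bounded there and has finite integral. \<open>W\<close> is the preimage
  of the open ball, which keeps it open.\<close>

lemma emeasure_homeomorphic_ball_finite:
  fixes c :: "('m::{second_countable_topology, t2_space}, 'n::finite) chart"
  assumes "is_chart c" "x \<in> fst c" "continuous_on (chart_image c) h"
    and sets: "sets \<nu> = sets borel"
    and vol: "\<And>B. B \<in> sets borel \<Longrightarrow> B \<subseteq> fst c \<Longrightarrow>
      emeasure \<nu> B = (\<integral>\<^sup>+y\<in>snd c ` B. ennreal (h y) \<partial>lborel)"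
  shows "\<exists>W. open W \<and> x \<in> W \<and> emeasure \<nu> W < \<infinity>"
proof -
  have "open (fst c)" "open (chart_image c)"
    and hom: "homeomorphism (fst c) (chart_image c) (snd c) (chart_inv c)"
    using assms(1) by (auto simp: is_chart_def)
  have "snd c x \<in> chart_image c"
    using assms(2) by (auto simp: chart_image_def)
  then obtain r where r: "r > 0" "cball (snd c x) r \<subseteq> chart_image c"
    using \<open>open (chart_image c)\<close> open_contains_cball by blast
  have "compact (h ` cball (snd c x) r)"
    using r(2) assms(3) by (intro compact_continuous_image continuous_on_subset[OF assms(3)]) auto
  then have "bounded (h ` cball (snd c x) r)"
    by (rule compact_imp_bounded)
  then obtain K where K: "\<And>y. y \<in> cball (snd c x) r \<Longrightarrow> \<bar>h y\<bar> \<le> K"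
    unfolding bounded_iff real_norm_def by blast
  define W where "W = fst c \<inter> snd c -` ball (snd c x) r"
  have "continuous_on (fst c) (snd c)"
    using hom by (simp add: homeomorphism_def)
  then have "open W"
    unfolding W_def using \<open>open (fst c)\<close> by (intro continuous_open_preimage) auto
  have "emeasure \<nu> W = (\<integral>\<^sup>+y\<in>snd c ` W. ennreal (h y) \<partial>lborel)"
    using \<open>open W\<close> by (intro vol) (auto simp: W_def)
  also have "\<dots> \<le> (\<integral>\<^sup>+y. ennreal K * indicator (cball (snd c x) r) y \<partial>lborel)"
  proof (intro nn_integral_mono)
    fix y
    show "ennreal (h y) * indicator (snd c ` W) y \<le> ennreal K * indicator (cball (snd c x) r) y"
    proof (cases "y \<in> snd c ` W")
      case True
      then have y: "y \<in> cball (snd c x) r"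
        by (auto simp: W_def)
      have "h y \<le> K"
        using K[OF y] by simp
      then show ?thesis
        using True y by (simp add: ennreal_leI)
    qed simp
  qed
  also have "\<dots> = ennreal K * emeasure lborel (cball (snd c x) r)"
    by (subst nn_integral_cmult_indicator) auto
  also have "\<dots> < \<infinity>"
    using emeasure_compact_finite[of "cball (snd c x) r"]
    by (simp add: ennreal_mult_less_top)
  finally show ?thesis
    using \<open>open W\<close> assms(2) r(1) by (intro exI[of _ W]) (auto simp: W_def)
qed

text \<open>Finitely many neighbourhoods of finite measure cover the space, and measure is
  subadditive.\<close>

lemma compact_locally_finite_emeasure_finite:
  fixes \<nu> :: "'m::topological_space measure"
  assumes "compact (UNIV :: 'm set)" "sets \<nu> = sets borel"
    and "\<And>x::'m. \<exists>W. open W \<and> x \<in> W \<and> emeasure \<nu> W < \<infinity>"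
  shows "emeasure \<nu> UNIV < \<infinity>"
proof -
  obtain W where W: "\<And>x::'m. open (W x) \<and> x \<in> W x \<and> emeasure \<nu> (W x) < \<infinity>"
    using assms(3) by metis
  obtain F where F: "finite F" "UNIV \<subseteq> (\<Union>x\<in>F. W x)"
    using W by (auto intro: compactE_image[OF assms(1), of UNIV W])
  have sets: "W ` F \<subseteq> sets \<nu>"
    using W assms(2) by auto
  have "emeasure \<nu> UNIV \<le> emeasure \<nu> (\<Union>x\<in>F. W x)"
    using F sets by (intro emeasure_mono) auto
  also have "\<dots> \<le> (\<Sum>x\<in>F. emeasure \<nu> (W x))"
    using F(1) sets by (rule emeasure_subadditive_finite)
  also have "\<dots> < \<infinity>"
    using W F(1) by (auto simp: less_top)
  finally show ?thesis .
qed

text \<open>By the Leibniz formula the determinant is a polynomial in the entries.\<close>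

lemma continuous_on_det:
  fixes G :: "'a::topological_space \<Rightarrow> real ^ 'n ^ 'n"
  assumes "continuous_on S G"
  shows "continuous_on S (\<lambda>x. det (G x))"
  unfolding det_def
  by (intro continuous_intros assms)

text \<open>The metric is continuous in each chart, hence so is the density
  \<open>sqrt (det (g c y))\<close>, and the two preceding lemmas apply to the Borel measure.
  Completion does not change the measure of the whole space.\<close>

lemma riemannian_volume_finite_measure:
  assumes "compact_riemannian_manifold A g" "riemannian_volume A g vol"
  shows "finite_measure vol" "space vol = UNIV"
proof -
  obtain \<nu> where \<nu>: "sets \<nu> = sets borel"
    "\<And>c B. c \<in> A \<Longrightarrow> B \<in> sets borel \<Longrightarrow> B \<subseteq> fst c \<Longrightarrow>
      emeasure \<nu> B = (\<integral>\<^sup>+y\<in>snd c ` B. ennreal (sqrt (det (g c y))) \<partial>lborel)"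
    "vol = completion \<nu>"
    using assms(2) unfolding riemannian_volume_def by blast
  have "\<exists>W. open W \<and> x \<in> W \<and> emeasure \<nu> W < \<infinity>" for x
  proof -
    obtain c where c: "c \<in> A" "x \<in> fst c" "is_chart c"
      using assms(1) unfolding compact_riemannian_manifold_def smooth_atlas_def by blast
    have "smooth_on (g c) (chart_image c)"
      using assms(1) c(1) by (auto simp: compact_riemannian_manifold_def riemannian_metric_def)
    then have "continuous_on (chart_image c) (g c)"
      unfolding smooth_on_def by (metis Ck_on.simps(1))
    then have "continuous_on (chart_image c) (\<lambda>y. sqrt (det (g c y)))"
      by (intro continuous_on_real_sqrt continuous_on_det)
    then show ?thesis
      using c \<nu> by (intro emeasure_homeomorphic_ball_finite[of c]) auto
  qed
  then have fin: "emeasure \<nu> UNIV < \<infinity>"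
    using assms(1) \<nu>(1)
    by (intro compact_locally_finite_emeasure_finite) (auto simp: compact_riemannian_manifold_def)
  have space: "space \<nu> = UNIV"
    using sets_eq_imp_space_eq[OF \<nu>(1)] by simp
  then show "space vol = UNIV"
    by (simp add: \<nu>(3))
  show "finite_measure vol"
    using fin \<nu>(1) by (intro finite_measureI) (simp add: \<nu>(3) space)
qed


section \<open>Square integrable functions\<close>

text \<open>A weighted Cauchy-Schwarz inequality. The weights \<open>s = t = 1\<close> give closure
  under addition; weights close to the two norms give the triangle inequality after
  integration.\<close>

lemma cmod_add_squared_le:
  fixes a b :: complex and s t :: real
  assumes "s > 0" "t > 0"
  shows "(cmod (a + b))\<^sup>2 \<le> (s + t) * ((cmod a)\<^sup>2 / s + (cmod b)\<^sup>2 / t)"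
proof -
  have "(cmod (a + b))\<^sup>2 \<le> (cmod a + cmod b)\<^sup>2"
    by (intro power_mono norm_triangle_ineq) auto
  also have "\<dots> \<le> (s + t) * ((cmod a)\<^sup>2 / s + (cmod b)\<^sup>2 / t)"
  proof -
    have "(s + t) * ((cmod a)\<^sup>2 / s + (cmod b)\<^sup>2 / t) - (cmod a + cmod b)\<^sup>2
        = (t * cmod a - s * cmod b)\<^sup>2 / (s * t)"
      using assms by (simp add: field_simps power2_eq_square)
    also have "\<dots> \<ge> 0"
      using assms by simp
    finally show ?thesis by simp
  qed
  finally show ?thesis .
qed

section \<open>Sums, multiples, restrictions and products of square integrable functions\<close>

lemma square_integrable_add:
  assumes "square_integrable M u" "square_integrable M v"
  shows "square_integrable M (\<lambda>x. u x + v x)"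
proof -
  have [measurable]: "u \<in> borel_measurable M" "v \<in> borel_measurable M"
    using assms by (auto simp: square_integrable_def)
  have "integrable M (\<lambda>x. (1 + 1) * ((cmod (u x))\<^sup>2 / 1 + (cmod (v x))\<^sup>2 / 1))"
    using assms by (intro integrable_mult_right Bochner_Integration.integrable_add)
      (auto simp: square_integrable_def)
  then have "integrable M (\<lambda>x. (cmod (u x + v x))\<^sup>2)"
  proof (rule Bochner_Integration.integrable_bound)
    show "AE x in M. norm ((cmod (u x + v x))\<^sup>2)
        \<le> norm ((1 + 1) * ((cmod (u x))\<^sup>2 / 1 + (cmod (v x))\<^sup>2 / 1))"
      using cmod_add_squared_le[of 1 1] by (intro AE_I2) auto
  qed simp
  then show ?thesis
    by (simp add: square_integrable_def)
qed

lemma square_integrable_cmult: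
  assumes "square_integrable M u"
  shows "square_integrable M (\<lambda>x. a * u x)"
  using assms by (auto simp: square_integrable_def norm_mult power_mult_distrib)

lemma square_integrable_sum:
  assumes "\<And>j. j \<in> F \<Longrightarrow> square_integrable M (u j)"
  shows "square_integrable M (\<lambda>x. \<Sum>j\<in>F. u j x)"
  using assms
proof (induction F rule: infinite_finite_induct)
  case (insert j F)
  then show ?case
    by (simp add: square_integrable_add)
qed (auto simp: square_integrable_def)

lemma square_integrable_diff:
  assumes "square_integrable M u" "square_integrable M v"
  shows "square_integrable M (\<lambda>x. u x - v x)"
  using square_integrable_add[OF assms(1) square_integrable_cmult[OF assms(2), of "-1"]] by simp

lemma square_integrable_indicator:
  assumes "square_integrable M u" "E \<in> sets M"
  shows "square_integrable M (\<lambda>x. indicator E x * u x)"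
proof -
  have [measurable]: "u \<in> borel_measurable M" "E \<in> sets M"
    using assms by (auto simp: square_integrable_def)
  have "integrable M (\<lambda>x. (cmod (indicator E x * u x))\<^sup>2)"
    using assms(1) unfolding square_integrable_def
    by (auto intro!: Bochner_Integration.integrable_bound[of M "\<lambda>x. (cmod (u x))\<^sup>2"] AE_I2
        simp: indicator_def)
  then show ?thesis
    by (simp add: square_integrable_def)
qed

lemma integrable_mult_cnj:
  assumes "square_integrable M u" "square_integrable M v"
  shows "integrable M (\<lambda>x. u x * cnj (v x))"
proof -
  have [measurable]: "u \<in> borel_measurable M" "v \<in> borel_measurable M"
    using assms by (auto simp: square_integrable_def)
  have "integrable M (\<lambda>x. (cmod (u x))\<^sup>2 + (cmod (v x))\<^sup>2)"
    using assms by (auto simp: square_integrable_def)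
  then show ?thesis
  proof (rule Bochner_Integration.integrable_bound)
    show "(\<lambda>x. u x * cnj (v x)) \<in> borel_measurable M"
      by (intro borel_measurable_times measurable_compose[of v M borel cnj]
          borel_measurable_continuous_onI continuous_intros) auto
    have "cmod (u x) * cmod (v x) \<le> (cmod (u x))\<^sup>2 + (cmod (v x))\<^sup>2" for x
    proof -
      \<comment> \<open>The square gives twice the product as a lower bound for the sum of squares;
        nonnegativity of the product then allows one copy to be dropped.\<close>
      have "0 \<le> (cmod (u x) - cmod (v x))\<^sup>2" "0 \<le> cmod (u x) * cmod (v x)" by auto
      then show ?thesis unfolding power2_diff by linarith
    qed
    then show "AE x in M. norm (u x * cnj (v x)) \<le> norm ((cmod (u x))\<^sup>2 + (cmod (v x))\<^sup>2)"
      by (intro AE_I2) (auto simp: norm_mult)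
  qed
qed

section \<open>The norm: triangle inequality, restriction and completing the square\<close>

lemma L2_norm_nonneg: "0 \<le> L2_norm M u"
  by (simp add: L2_norm_def)

lemma L2_norm_squared: "(L2_norm M u)\<^sup>2 = (LINT x|M. (cmod (u x))\<^sup>2)"
  by (simp add: L2_norm_def)

text \<open>Integrating the weighted pointwise inequality with \<open>s\<close> and \<open>t\<close>
  near the norms of \<open>u\<close> and \<open>v\<close> bounds the squared norm of the sum by
  \<open>(s + t)\<^sup>2\<close>.\<close>

lemma L2_norm_triangle:
  assumes "square_integrable M u" "square_integrable M v"
  shows "L2_norm M (\<lambda>x. u x + v x) \<le> L2_norm M u + L2_norm M v"
proof (rule field_le_epsilon)
  fix d :: real assume "d > 0"
  \<comment> \<open>The shift by \<open>d / 2\<close> keeps both weights positive even when a norm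
    vanishes, and costs \<open>d\<close> in total.\<close>
  define s where "s = L2_norm M u + d / 2"
  define t where "t = L2_norm M v + d / 2"
  have pos: "s > 0" "t > 0"
    using \<open>d > 0\<close> L2_norm_nonneg[of M u] L2_norm_nonneg[of M v] by (auto simp: s_def t_def)
  have "(L2_norm M u)\<^sup>2 \<le> s\<^sup>2" "(L2_norm M v)\<^sup>2 \<le> t\<^sup>2"
    using \<open>d > 0\<close> by (auto intro!: power_mono simp: s_def t_def L2_norm_nonneg)
  then have le: "(L2_norm M u)\<^sup>2 / s \<le> s" "(L2_norm M v)\<^sup>2 / t \<le> t"
    using pos by (simp_all add: divide_le_eq power2_eq_square)
  have int: "integrable M (\<lambda>x. (cmod (u x))\<^sup>2)" "integrable M (\<lambda>x. (cmod (v x))\<^sup>2)"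
    "integrable M (\<lambda>x. (cmod (u x + v x))\<^sup>2)"
    using assms square_integrable_add[OF assms] by (simp_all add: square_integrable_def)
  have "(L2_norm M (\<lambda>x. u x + v x))\<^sup>2
      \<le> (LINT x|M. (s + t) * ((cmod (u x))\<^sup>2 / s + (cmod (v x))\<^sup>2 / t))"
    unfolding L2_norm_squared
    by (intro integral_mono int integrable_mult_right Bochner_Integration.integrable_add
        integrable_divide cmod_add_squared_le pos)
  also have "\<dots> = (s + t) * ((L2_norm M u)\<^sup>2 / s + (L2_norm M v)\<^sup>2 / t)"
    using int by (simp add: L2_norm_squared)
  also have "\<dots> \<le> (s + t) * (s + t)"
    using pos by (intro mult_left_mono add_mono le) simp
  finally have "(L2_norm M (\<lambda>x. u x + v x))\<^sup>2 \<le> (s + t)\<^sup>2"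
    by (simp add: power2_eq_square)
  then have "L2_norm M (\<lambda>x. u x + v x) \<le> s + t"
    by (rule power2_le_imp_le) (use pos in simp)
  then show "L2_norm M (\<lambda>x. u x + v x) \<le> L2_norm M u + L2_norm M v + d"
    by (simp add: s_def t_def)
qed

lemma L2_norm_indicator_le:
  assumes "square_integrable M u" "E \<in> sets M"
  shows "L2_norm M (\<lambda>x. indicator E x * u x) \<le> L2_norm M u"
proof -
  have "(cmod (indicator E x * u x))\<^sup>2 \<le> (cmod (u x))\<^sup>2" for x
    by (simp add: indicator_def)
  then show ?thesis
    using assms square_integrable_indicator[OF assms]
    by (auto simp: L2_norm_def square_integrable_def intro!: integral_mono)
qed

lemma L2_inner_self: "L2_inner M u u = complex_of_real ((L2_norm M u)\<^sup>2)"
  unfolding L2_norm_squared L2_inner_def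
  by (simp flip: integral_complex_of_real complex_norm_square)

lemma L2_norm_eq_1_if_inner:
  assumes "L2_inner M u u = 1"
  shows "L2_norm M u = 1"
proof -
  have "(L2_norm M u)\<^sup>2 = 1"
    using assms unfolding L2_inner_self by (simp only: of_real_eq_1_iff)
  then show ?thesis
    using L2_norm_nonneg[of M u] power2_eq_1_iff by force
qed

text \<open>Completing the square in \<open>a\<close>. The computation takes place among complex
  inner products; the real identity follows because \<open>of_real\<close> is injective.\<close>

lemma L2_norm_diff_cmult_squared:
  assumes "square_integrable M h" "square_integrable M e" "L2_inner M e e = 1"
  shows "(L2_norm M (\<lambda>x. h x - a * e x))\<^sup>2
    = (L2_norm M h)\<^sup>2 - (cmod (L2_inner M h e))\<^sup>2 + (cmod (a - L2_inner M h e))\<^sup>2"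
proof -
  have int: "integrable M (\<lambda>x. h x * cnj (h x))" "integrable M (\<lambda>x. h x * cnj (e x))"
    "integrable M (\<lambda>x. e x * cnj (h x))" "integrable M (\<lambda>x. e x * cnj (e x))"
    using assms by (auto intro: integrable_mult_cnj)
  have cnj: "L2_inner M e h = cnj (L2_inner M h e)"
    unfolding L2_inner_def
    by (subst Bochner_Integration.integral_cnj[symmetric]) (simp add: mult.commute)
  have "L2_inner M (\<lambda>x. h x - a * e x) (\<lambda>x. h x - a * e x)
    = (LINT x|M. h x * cnj (h x) - cnj a * (h x * cnj (e x)) - a * (e x * cnj (h x))
        + a * cnj a * (e x * cnj (e x)))"
    unfolding L2_inner_def by (intro Bochner_Integration.integral_cong refl) (simp add: algebra_simps)
  also have "\<dots> = L2_inner M h h - cnj a * L2_inner M h e - a * L2_inner M e h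
      + a * cnj a * L2_inner M e e"
    unfolding L2_inner_def using int by simp
  also have "\<dots> = complex_of_real ((L2_norm M h)\<^sup>2 - (cmod (L2_inner M h e))\<^sup>2
      + (cmod (a - L2_inner M h e))\<^sup>2)"
    by (simp add: L2_inner_self[of M h] cnj assms(3) complex_norm_square del: of_real_power)
      (simp add: algebra_simps)
  finally show ?thesis
    unfolding L2_inner_self by (simp only: of_real_eq_iff)
qed


section \<open>Orthonormal expansions\<close>

lemma L2_inner_sum_left:
  assumes "\<And>j. j \<in> F \<Longrightarrow> square_integrable M (u j)" "square_integrable M v"
  shows "L2_inner M (\<lambda>x. \<Sum>j\<in>F. a j * u j x) v = (\<Sum>j\<in>F. a j * L2_inner M (u j) v)"
proof -
  have "L2_inner M (\<lambda>x. \<Sum>j\<in>F. a j * u j x) v = (LINT x|M. (\<Sum>j\<in>F. a j * (u j x * cnj (v x))))"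
    unfolding L2_inner_def by (simp add: sum_distrib_right mult.assoc)
  also have "\<dots> = (\<Sum>j\<in>F. a j * L2_inner M (u j) v)"
    unfolding L2_inner_def using assms
    by (subst Bochner_Integration.integral_sum) (auto intro!: integrable_mult_right integrable_mult_cnj)
  finally show ?thesis .
qed

lemma L2_inner_diff_left:
  assumes "square_integrable M u" "square_integrable M v" "square_integrable M w"
  shows "L2_inner M (\<lambda>x. u x - v x) w = L2_inner M u w - L2_inner M v w"
  unfolding L2_inner_def using assms
  by (simp add: left_diff_distrib integrable_mult_cnj)

text \<open>Vectors are subtracted one at a time by the preceding square completion. Taking
  \<open>a\<close> to be the Fourier coefficients gives Pythagoras and Bessel; arbitrary
  \<open>a\<close> lets the density of finite combinations yield Parseval.\<close>

lemma L2_norm_diff_expansion_squared: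
  assumes e: "\<And>j. square_integrable M (e j)"
    and orth: "\<And>j k. L2_inner M (e j) (e k) = (if j = k then 1 else 0)"
    and f: "square_integrable M f" and "finite F"
  shows "(L2_norm M (\<lambda>x. f x - (\<Sum>j\<in>F. a j * e j x)))\<^sup>2
    = (L2_norm M f)\<^sup>2 - (\<Sum>j\<in>F. (cmod (fourier_coeff M e f j))\<^sup>2)
      + (\<Sum>j\<in>F. (cmod (a j - fourier_coeff M e f j))\<^sup>2)"
  using \<open>finite F\<close>
proof (induction F)
  case empty
  then show ?case by simp
next
  case (insert k F)
  define h where "h = (\<lambda>x. f x - (\<Sum>j\<in>F. a j * e j x))"
  have sq: "square_integrable M (\<lambda>x. \<Sum>j\<in>F. a j * e j x)"
    by (intro square_integrable_sum square_integrable_cmult e)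
  then have h: "square_integrable M h"
    unfolding h_def by (intro square_integrable_diff f)
  \<comment> \<open>The new vector is orthogonal to those already subtracted, so the remainder
    \<open>h\<close> has the same \<open>k\<close>-th coefficient as \<open>f\<close>.\<close>
  have "L2_inner M h (e k) = L2_inner M f (e k) - (\<Sum>j\<in>F. a j * L2_inner M (e j) (e k))"
    unfolding h_def by (simp add: L2_inner_diff_left L2_inner_sum_left sq f e)
  also have "(\<Sum>j\<in>F. a j * L2_inner M (e j) (e k)) = 0"
    using insert.hyps by (intro sum.neutral) (auto simp: orth)
  finally have inner: "L2_inner M h (e k) = fourier_coeff M e f k"
    by (simp add: L2_inner_def fourier_coeff_def)
  have "(\<lambda>x. f x - (\<Sum>j\<in>insert k F. a j * e j x)) = (\<lambda>x. h x - a k * e k x)"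
    using insert.hyps by (simp add: h_def fun_eq_iff)
  then show ?case
    using L2_norm_diff_cmult_squared[OF h e, of k "a k"] insert
    by (simp add: orth inner) (simp add: h_def)
qed

text \<open>The half of Parseval that uses completeness. Summability is a premise because the
  integral of a non-integrable function is 0 by convention; concentration of the coefficients
  supplies it.\<close>

lemma L2_norm_squared_le_fourier_sum:
  assumes onb: "orthonormal_basis M e" and f: "square_integrable M f"
    and int: "integrable (count_space UNIV) (\<lambda>j. (cmod (fourier_coeff M e f j))\<^sup>2)"
  shows "(L2_norm M f)\<^sup>2 \<le> (LINT j|count_space UNIV. (cmod (fourier_coeff M e f j))\<^sup>2)"
proof (rule field_le_epsilon)
  fix d :: real assume "d > 0"
  then obtain n a where na: "L2_norm M (\<lambda>x. f x - (\<Sum>j<n. a j * e j x)) < sqrt d"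
    using onb f unfolding orthonormal_basis_def by (metis real_sqrt_gt_zero)
  have "(L2_norm M f)\<^sup>2 \<le> (\<Sum>j<n. (cmod (fourier_coeff M e f j))\<^sup>2)
      + (L2_norm M (\<lambda>x. f x - (\<Sum>j<n. a j * e j x)))\<^sup>2"
    using onb f unfolding orthonormal_basis_def
    by (subst L2_norm_diff_expansion_squared) (auto intro: sum_nonneg)
  moreover have "(L2_norm M (\<lambda>x. f x - (\<Sum>j<n. a j * e j x)))\<^sup>2 \<le> d"
    using power_mono[OF less_imp_le[OF na] L2_norm_nonneg, of 2] \<open>d > 0\<close> by simp
  moreover have "(\<Sum>j<n. (cmod (fourier_coeff M e f j))\<^sup>2)
      \<le> (LINT j|count_space UNIV. (cmod (fourier_coeff M e f j))\<^sup>2)"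
    using int unfolding integrable_count_space_nat_iff
    by (subst integral_count_space_nat[OF int]) (auto intro!: sum_le_suminf)
  ultimately show "(L2_norm M f)\<^sup>2
      \<le> (LINT j|count_space UNIV. (cmod (fourier_coeff M e f j))\<^sup>2) + d"
    by linarith
qed

text \<open>Integrating the pointwise bound turns each unit vector into a contribution of 1, so
  finite subsets of \<open>X\<close> have at most \<open>c\<close> times the total measure many
  elements.\<close>

lemma finite_if_sum_squares_bounded:
  assumes "finite_measure M" and X: "\<And>j. j \<in> X \<Longrightarrow> square_integrable M (e j)"
    and norm: "\<And>j. j \<in> X \<Longrightarrow> L2_norm M (e j) = 1"
    and bound: "\<And>x F. finite F \<Longrightarrow> F \<subseteq> X \<Longrightarrow> (\<Sum>j\<in>F. (cmod (e j x))\<^sup>2) \<le> c"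
  shows "finite X"
proof -
  interpret finite_measure M by fact
  have "card F \<le> nat \<lceil>c * measure M (space M)\<rceil>" if F: "F \<subseteq> X" "finite F" for F
  proof -
    have int: "integrable M (\<lambda>x. (cmod (e j x))\<^sup>2)" if "j \<in> F" for j
      using X F that by (auto simp: square_integrable_def)
    have "real (card F) = (\<Sum>j\<in>F. (L2_norm M (e j))\<^sup>2)"
      using norm F by (simp add: subset_iff)
    also have "\<dots> = (LINT x|M. (\<Sum>j\<in>F. (cmod (e j x))\<^sup>2))"
      using int by (simp add: L2_norm_squared)
    also have "\<dots> \<le> (LINT x|M. c)"
      using int bound[OF F(2,1)] by (intro integral_mono) auto
    also have "\<dots> = c * measure M (space M)"
      by simp
    finally show ?thesis
      by linarith
  qed
  then show ?thesis
    using finite_if_finite_subsets_card_bdd by blast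
qed


section \<open>The uncertainty principle\<close>

text \<open>With this level, squaring the norm inequality clears both the roots and the negative
  power.\<close>

lemma Lp_concentrated_2D:
  assumes "Lp_concentrated 2 M E ((1 - \<epsilon>\<^sup>2) powr (-1/2)) f" "0 \<le> \<epsilon>" "\<epsilon> < 1"
  shows "(1 - \<epsilon>\<^sup>2) * (LINT x|M. (cmod (f x))\<^sup>2) \<le> (LINT x:E|M. (cmod (f x))\<^sup>2)"
    and "integrable M (\<lambda>x. (cmod (f x))\<^sup>2)"
proof -
  have [simp]: "cmod z powr 2 = (cmod z)\<^sup>2" for z
    by simp
  define I where "I = (LINT x|M. (cmod (f x))\<^sup>2)"
  define J where "J = (LINT x:E|M. (cmod (f x))\<^sup>2)"
  define q where "q = 1 - \<epsilon>\<^sup>2"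
  have "q > 0"
    using assms(2,3) by (simp add: q_def power_less_one_iff abs_square_less_1)
  have "0 \<le> I" "0 \<le> J"
    by (auto simp: I_def J_def set_lebesgue_integral_def)
  have "I powr (1/2) \<le> q powr (-1/2) * J powr (1/2)"
    using assms(1) unfolding Lp_concentrated_def I_def J_def q_def by simp
  then have "sqrt I \<le> sqrt J / sqrt q"
    using \<open>0 \<le> I\<close> \<open>0 \<le> J\<close> \<open>q > 0\<close> by (simp add: powr_half_sqrt powr_minus_divide)
  then have "I \<le> J / q"
    by (simp flip: real_sqrt_divide)
  then show "(1 - \<epsilon>\<^sup>2) * (LINT x|M. (cmod (f x))\<^sup>2) \<le> (LINT x:E|M. (cmod (f x))\<^sup>2)"
    using \<open>q > 0\<close> unfolding I_def[symmetric] J_def[symmetric] q_def[symmetric]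
    by (simp add: field_simps)
  show "integrable M (\<lambda>x. (cmod (f x))\<^sup>2)"
    using assms(1) by (simp add: Lp_concentrated_def)
qed

text \<open>Restriction to \<open>E\<close> is treated as multiplication by the indicator, so that
  norms over \<open>E\<close> obey the triangle inequality on \<open>M\<close>.\<close>

lemma L2_norm_indicator_squared:
  "(L2_norm M (\<lambda>x. indicator E x * f x))\<^sup>2 = (LINT x:E|M. (cmod (f x))\<^sup>2)"
  unfolding L2_norm_squared set_lebesgue_integral_def
  by (intro Bochner_Integration.integral_cong) (auto simp: indicator_def)

theorem orthonormal_basis_uncertainty:
  assumes "finite_measure M" and onb: "orthonormal_basis M e"
    and E: "E \<in> sets M" and "finite X"
    and f: "square_integrable M f" and f0: "\<not> (AE x in M. f x = 0)"
    and \<epsilon>: "0 \<le> \<epsilon>" "\<epsilon> < 1" and \<epsilon>': "0 \<le> \<epsilon>'" "\<epsilon>' < 1" and "\<epsilon> + \<epsilon>' \<le> 1"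
    and conc: "Lp_concentrated 2 M E ((1 - \<epsilon>\<^sup>2) powr (-1/2)) f"
    and conc': "Lp_concentrated 2 (count_space UNIV) X ((1 - \<epsilon>'\<^sup>2) powr (-1/2)) (fourier_coeff M e f)"
    and const: "\<And>x. x \<in> space M \<Longrightarrow> (\<Sum>j\<in>X. (cmod (e j x))\<^sup>2) = C"
  shows "(1 - \<epsilon> - \<epsilon>')\<^sup>2 \<le> real (card X) * (measure M E / measure M (space M))"
proof -
  interpret finite_measure M by fact
  have e: "square_integrable M (e j)" for j
    using onb by (simp add: orthonormal_basis_def)
  have orth: "L2_inner M (e j) (e k) = (if j = k then 1 else 0)" for j k
    using onb by (simp add: orthonormal_basis_def)
  have norm_e: "(LINT x|M. (cmod (e j x))\<^sup>2) = 1" for j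
    using L2_norm_eq_1_if_inner[of M "e j"] orth[of j j] L2_norm_squared[of M "e j"] by simp
  \<comment> \<open>On a null space \<open>f\<close> would vanish almost everywhere. Positive volume
    is what permits solving for \<open>C\<close>.\<close>
  have "measure M (space M) \<noteq> 0"
  proof
    assume "measure M (space M) = 0"
    then have "space M \<in> null_sets M"
      by (simp add: emeasure_eq_measure null_setsI)
    then show False
      using f0 AE_I'[of "space M" M] by blast
  qed
  then have V: "measure M (space M) > 0"
    by (simp add: zero_less_measure_iff)
  have "real (card X) = (\<Sum>j\<in>X. (LINT x|M. (cmod (e j x))\<^sup>2))"
    by (simp add: norm_e)
  also have "\<dots> = (LINT x|M. (\<Sum>j\<in>X. (cmod (e j x))\<^sup>2))"
    using e by (simp add: square_integrable_def)
  also have "\<dots> = (LINT x|M. C)"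
    by (intro Bochner_Integration.integral_cong) (auto simp: const)
  finally have C: "C = real (card X) / measure M (space M)"
    using V by (simp add: field_simps)
  define P where "P = (\<lambda>x. \<Sum>j\<in>X. fourier_coeff M e f j * e j x)"
  have P: "square_integrable M P"
    unfolding P_def by (intro square_integrable_sum square_integrable_cmult e)
  define A where "A = L2_norm M f"
  have A: "A > 0"
  proof -
    have "(LINT x|M. (cmod (f x))\<^sup>2) \<noteq> 0"
      using f f0 by (subst integral_nonneg_eq_0_iff_AE) (auto simp: square_integrable_def)
    then show ?thesis
      by (simp add: A_def L2_norm_def less_le)
  qed
  \<comment> \<open>With \<open>a\<close> equal to the Fourier coefficients the last sum of the
    expansion vanishes. Nonnegativity of the left side then gives Bessel's inequality
    \<open>T \<le> A\<^sup>2\<close>.\<close>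
  have diff: "(L2_norm M (\<lambda>x. f x - P x))\<^sup>2 = A\<^sup>2 - (\<Sum>j\<in>X. (cmod (fourier_coeff M e f j))\<^sup>2)"
    unfolding P_def A_def
    using L2_norm_diff_expansion_squared[OF e orth f \<open>finite X\<close>] by simp
  define T where "T = (\<Sum>j\<in>X. (cmod (fourier_coeff M e f j))\<^sup>2)"
  have "T \<le> A\<^sup>2"
    using diff zero_le_power2[of "L2_norm M (\<lambda>x. f x - P x)"] unfolding T_def by linarith
  have "(1 - \<epsilon>'\<^sup>2) * A\<^sup>2 \<le> T"
  proof -
    have "1 - \<epsilon>'\<^sup>2 \<ge> 0"
      using \<epsilon>' by (simp add: power_le_one)
    then have "(1 - \<epsilon>'\<^sup>2) * A\<^sup>2
        \<le> (1 - \<epsilon>'\<^sup>2) * (LINT j|count_space UNIV. (cmod (fourier_coeff M e f j))\<^sup>2)"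
      unfolding A_def using L2_norm_squared_le_fourier_sum[OF onb f]
        Lp_concentrated_2D(2)[OF conc' \<epsilon>'] by (intro mult_left_mono) auto
    also have "\<dots> \<le> (LINT j:X|count_space UNIV. (cmod (fourier_coeff M e f j))\<^sup>2)"
      by (rule Lp_concentrated_2D(1)[OF conc' \<epsilon>'])
    \<comment> \<open>The integral first becomes a sum over the support of the integrand, which can
      be smaller than \<open>X\<close> when coefficients vanish; adding zero terms restores
      \<open>X\<close>.\<close>
    also have "\<dots> = (\<Sum>j | j \<in> UNIV \<and> indicat_real X j *\<^sub>R (cmod (fourier_coeff M e f j))\<^sup>2 \<noteq> 0.
        indicat_real X j *\<^sub>R (cmod (fourier_coeff M e f j))\<^sup>2)"
      unfolding set_lebesgue_integral_def
      by (rule lebesgue_integral_count_space_finite_support, rule finite_subset[OF _ \<open>finite X\<close>])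
        (auto simp: indicator_def)
    also have "\<dots> = T"
      unfolding T_def by (rule sum.mono_neutral_cong_left[OF \<open>finite X\<close>]) (auto simp: indicator_def)
    finally show ?thesis .
  qed
  then have "(L2_norm M (\<lambda>x. f x - P x))\<^sup>2 \<le> (\<epsilon>' * A)\<^sup>2"
    using diff by (simp add: T_def algebra_simps power_mult_distrib)
  then have tail: "L2_norm M (\<lambda>x. f x - P x) \<le> \<epsilon>' * A"
    by (rule power2_le_imp_le) (use A \<epsilon>' in simp)
  have "((1 - \<epsilon>) * A)\<^sup>2 \<le> (L2_norm M (\<lambda>x. indicator E x * f x))\<^sup>2"
  proof -
    \<comment> \<open>The smaller factor is a perfect square, so the norm bound becomes linear in
      \<epsilon> and the tail \<open>\<epsilon>' * A\<close> can be subtracted from it.\<close>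
    have "(1 - \<epsilon>)\<^sup>2 \<le> 1 - \<epsilon>\<^sup>2"
    proof -
      have "(1 - \<epsilon>\<^sup>2) - (1 - \<epsilon>)\<^sup>2 = 2 * \<epsilon> * (1 - \<epsilon>)"
        by (simp add: power2_eq_square algebra_simps)
      also have "\<dots> \<ge> 0" using \<epsilon> by simp
      finally show ?thesis by simp
    qed
    then have "((1 - \<epsilon>) * A)\<^sup>2 \<le> (1 - \<epsilon>\<^sup>2) * A\<^sup>2"
      unfolding power_mult_distrib by (intro mult_right_mono) auto
    then show ?thesis
      using Lp_concentrated_2D(1)[OF conc \<epsilon>]
      unfolding L2_norm_indicator_squared A_def L2_norm_squared by (rule order_trans)
  qed
  then have "(1 - \<epsilon>) * A \<le> L2_norm M (\<lambda>x. indicator E x * f x)"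
    by (rule power2_le_imp_le[OF _ L2_norm_nonneg])
  also have "\<dots> = L2_norm M (\<lambda>x. indicator E x * P x + indicator E x * (f x - P x))"
    by (simp add: algebra_simps)
  also have "\<dots> \<le> L2_norm M (\<lambda>x. indicator E x * P x) + L2_norm M (\<lambda>x. indicator E x * (f x - P x))"
    by (intro L2_norm_triangle square_integrable_indicator square_integrable_diff P E f)
  also have "L2_norm M (\<lambda>x. indicator E x * (f x - P x)) \<le> L2_norm M (\<lambda>x. f x - P x)"
    by (intro L2_norm_indicator_le square_integrable_diff P E f)
  finally have "(1 - \<epsilon> - \<epsilon>') * A \<le> L2_norm M (\<lambda>x. indicator E x * P x)"
    using tail by (simp add: algebra_simps)
  then have "((1 - \<epsilon> - \<epsilon>') * A)\<^sup>2 \<le> (L2_norm M (\<lambda>x. indicator E x * P x))\<^sup>2"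
    \<comment> \<open>Squaring is monotone here since \<epsilon> + \<epsilon>' \<le> 1 makes the
      left side nonnegative.\<close>
    using A \<open>\<epsilon> + \<epsilon>' \<le> 1\<close> by (intro power_mono) auto
  also have "\<dots> \<le> (LINT x|M. A\<^sup>2 * C * indicator E x)"
    unfolding L2_norm_squared
  proof (rule integral_mono)
    show "integrable M (\<lambda>x. (cmod (indicator E x * P x))\<^sup>2)"
      using square_integrable_indicator[OF P E] by (simp add: square_integrable_def)
    show "integrable M (\<lambda>x. A\<^sup>2 * C * indicator E x)"
      using E by (simp add: integrable_real_indicator less_top[symmetric])
    fix x assume x: "x \<in> space M"
    have "cmod (P x) \<le> (\<Sum>j\<in>X. cmod (fourier_coeff M e f j) * cmod (e j x))"
      unfolding P_def by (rule sum_norm_le) (simp add: norm_mult)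
    then have "(cmod (P x))\<^sup>2 \<le> (\<Sum>j\<in>X. cmod (fourier_coeff M e f j) * cmod (e j x))\<^sup>2"
      by (intro power_mono) auto
    also have "\<dots> \<le> T * C"
      using Cauchy_Schwarz_ineq_sum[of "\<lambda>j. cmod (fourier_coeff M e f j)" "\<lambda>j. cmod (e j x)" X]
      by (simp add: T_def const[OF x])
    also have "\<dots> \<le> A\<^sup>2 * C"
      \<comment> \<open>The formula for \<open>C\<close> shows that it is nonnegative.\<close>
      using \<open>T \<le> A\<^sup>2\<close> C V by (intro mult_right_mono) auto
    finally show "(cmod (indicator E x * P x))\<^sup>2 \<le> A\<^sup>2 * C * indicator E x"
      by (auto simp: indicator_def)
  qed
  also have "\<dots> = A\<^sup>2 * (real (card X) * (measure M E / measure M (space M)))"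
    using E sets.sets_into_space[OF E] by (simp add: C Int_absorb2)
  finally have "A\<^sup>2 * (1 - \<epsilon> - \<epsilon>')\<^sup>2
      \<le> A\<^sup>2 * (real (card X) * (measure M E / measure M (space M)))"
    unfolding power_mult_distrib by (subst mult.commute)
  then show ?thesis
    by (rule mult_left_le_imp_le) (use A in simp)
qed

section \<open>Application to the joint eigenbasis on the manifold\<close>

theorem corollary1p18:
  fixes A :: "('m::{second_countable_topology, t2_space}, 'n::finite) chart set"
    and g :: "('m, 'n) chart \<Rightarrow> real ^ 'n \<Rightarrow> real ^ 'n ^ 'n"
    and vol :: "'m measure"
    and D :: "'k::finite \<Rightarrow> ('m \<Rightarrow> complex) \<Rightarrow> 'm \<Rightarrow> complex"
    and e :: "nat \<Rightarrow> 'm \<Rightarrow> complex"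
    and lam :: "nat \<Rightarrow> real ^ 'k"
    and E :: "'m set"
    and S :: "(real ^ 'k) set"
    and f :: "'m \<Rightarrow> complex"
    and L L' \<epsilon> \<epsilon>' :: real
  assumes "compact_riemannian_manifold A g"
    and "riemannian_volume A g vol"
    and "elliptic_system A vol D"
    and "joint_eigenbasis A vol D e lam"
    and "E \<in> sets vol"
    and "finite S" and "S \<subseteq> range lam"
    and "square_integrable vol f" and "\<not> (AE x in vol. f x = 0)"
    and "0 \<le> \<epsilon>" and "\<epsilon> < 1" and "0 \<le> \<epsilon>'" and "\<epsilon>' < 1" and "\<epsilon> + \<epsilon>' \<le> 1"
    and "L = (1 - \<epsilon>\<^sup>2) powr (-1/2)" and "L' = (1 - \<epsilon>'\<^sup>2) powr (-1/2)"
    and "Lp_concentrated 2 vol E L f"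
    and "Lp_concentrated 2 (count_space UNIV) {j. lam j \<in> S} L' (fourier_coeff vol e f)"
    and "\<forall>l\<in>range lam. \<exists>c::real. \<forall>x. ((\<lambda>j. (cmod (e j x))\<^sup>2) has_sum c) {j. lam j = l}"
  shows "real (card {j. lam j \<in> S}) * (measure vol E / measure vol UNIV) \<ge> (1 - \<epsilon> - \<epsilon>')\<^sup>2"
proof -
  have fin: "finite_measure vol" and space: "space vol = UNIV"
    using riemannian_volume_finite_measure assms(1,2) by blast+
  have onb: "orthonormal_basis vol e"
    using assms(4) by (simp add: joint_eigenbasis_def)
  have e: "square_integrable vol (e j)" for j
    using onb by (simp add: orthonormal_basis_def)
  have norm: "L2_norm vol (e j) = 1" for j
    using onb by (intro L2_norm_eq_1_if_inner) (simp add: orthonormal_basis_def)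
  obtain c where c: "\<And>l x. l \<in> range lam \<Longrightarrow> ((\<lambda>j. (cmod (e j x))\<^sup>2) has_sum c l) {j. lam j = l}"
    using assms(19) by metis
  \<comment> \<open>\<open>has_sum\<close> alone allows an infinite eigenspace, whose index set
    would have \<open>card\<close> equal to 0. The terms are nonnegative, so finite partial sums
    stay below \<open>c l\<close>, and finite volume bounds the multiplicity.\<close>
  have finl: "finite {j. lam j = l}" if "l \<in> range lam" for l
  proof (rule finite_if_sum_squares_bounded[OF fin e norm])
    fix x F assume "finite F" "F \<subseteq> {j. lam j = l}"
    then show "(\<Sum>j\<in>F. (cmod (e j x))\<^sup>2) \<le> c l"
      by (intro finite_sum_le_has_sum[OF c[OF that]]) auto
  qed
  have X: "{j. lam j \<in> S} = (\<Union>l\<in>S. {j. lam j = l})"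
    by auto
  have finX: "finite {j. lam j \<in> S}"
    unfolding X using finl assms(6,7) by auto
  \<comment> \<open>The index sets of distinct joint eigenvalues are disjoint, so their constants
    add up. Since \<open>S\<close> lies in the range of \<open>lam\<close>, every \<open>l\<close>
    in \<open>S\<close> has such a constant.\<close>
  have "(\<Sum>j\<in>{j. lam j \<in> S}. (cmod (e j x))\<^sup>2) = (\<Sum>l\<in>S. c l)" for x
  proof -
    have "(\<Sum>j\<in>{j. lam j \<in> S}. (cmod (e j x))\<^sup>2) = (\<Sum>l\<in>S. \<Sum>j\<in>{j. lam j = l}. (cmod (e j x))\<^sup>2)"
      unfolding X using finl assms(6,7) by (intro sum.UNION_disjoint) auto
    also have "\<dots> = (\<Sum>l\<in>S. c l)"
      using finl assms(7) c
      by (intro sum.cong refl has_sum_unique[OF has_sum_finite]) auto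
    finally show ?thesis .
  qed
  then show ?thesis
    using orthonormal_basis_uncertainty[OF fin onb assms(5) finX assms(8-14)] assms(15-18) space
    by simp
qed

end
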